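(* Let an instance of the resource-constrained project scheduling problem with discounted costs and cumulative resources be given, let $\epsilon>0$, and let (O) and (A) be the original time-indexed problem and its geometrically time-aggregated version, as defined in the context. Let $x^*$ be a feasible solution of (O). Define the $0/1$ array $X^*=(X^*_{js})_{j\in\mathcal{J},\,s\in\mathcal{T}_I}$ as follows: if $x^*_{jt}=1$ for some $t\in\mathcal{T}$, then $X^*_{j,\mathcal{I}(t)}=1$ and $X^*_{js}=0$ for all $s\in\mathcal{T}_I$ with $s\neq\mathcal{I}(t)$; if $x^*_{jt}=0$ for all $t\in\mathcal{T}$, then $X^*_{js}=0$ for all $s\in\mathcal{T}_I$. Then $X^*$ is a feasible solution of (A), and $\mathrm{NPV}(x^* )\le\widehat{\mathrm{NPV}}(X^* )$.
   Context: **Instance.** Jobs $\mathcal{J}=\{1,\dots,N\}$, time periods $\mathcal{T}=\{1,\dots,T\}$, resources $\mathcal{K}=\{1,\dots,K\}$. Each job $j$ has a revenue $f_j\in\mathbb{R}$ (collected when the job finishes; it may be negative), a processing time $p_j\in\mathbb{N}$, $p_j\ge 1$, a requirement $q_{jk}\ge 0$ of each resource $k$ in every period in which $j$ is active, and a set $\mathcal{P}_j\subset\mathcal{J}$ of jobs that must be finished before $j$ starts. $R_{kt}\ge 0$ is the amount of fresh resource $k$ arriving in period $t$; unused resources are carried over to later periods (cumulative resources). $r>0$ is the discount rate per period. Jobs are non-preemptive, and not every job has to be scheduled. The directed graph $G=(\mathcal{J},\mathcal{A})$ with $(j,k)\in\mathcal{A}$ iff $k\in\mathcal{P}_j$ is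 acyclic, and the precedence sets are assumed minimal (that is, $G$ equals its transitive reduction). $\hat{\mathcal{P}}_j$ is the set of jobs $k\ne j$ reachable from $j$ in $G$. For $k\in\hat{\mathcal{P}}_j$, $\Delta_{jk}$ is the length of the longest path from $j$ to $k$ in $G$, where an arc $(a,b)$ has length $p_a$. Write $y^+=\max\{y,0\}$. **Conventions.** $x_{ju}=0$ for $u\notin\mathcal{T}$, $X_{ju}=0$ for $u\notin\mathcal{T}_I$, and $R_{kt}=0$ for $t>T$; empty sums are $0$. **Original problem (O).** Binary variables $x_{jt}$ ($x_{jt}=1$ iff job $j$ finishes at period $t$, being active in periods $t-p_j+1,\dots,t$). Maximize $$\mathrm{NPV}(x)=\sum_{j=1}^N\sum_{t=1}^T\frac{f_j}{(1+r)^t}x_{jt}$$ subject to - $x_{jt}=0$ for $t<p_j$, $j\in\mathcal{J}$; - $\sum_{t=1}^T x_{jt}\le 1$ for $j\in\mathcal{J}$; - $\sum_{u=1}^t x_{ju}\le\sum_{u=1}^{t-p_j}x_{ku}$ for $j\in\mathcal{J}$, $k\in\mathcal{P}_j$, $t\in\mathcal{T}$; - $\sum_{j=1}^N\sum_{u=1}^{t+p_j-1}q_{jk}\,(p_j-(u-t)^+)\,x_{ju}\le\sum_{u=1}^tR_{ku}$ for $t\in\mathcal{T}$, $k\in\mathcal{K}$; - $x_{jt}\in\{0,1\}$ for $j\in\mathcal{J}$, $t\in\mathcal{T}$. **Geometric intervals.** For the aggregation parameter $\epsilon>0$ let $\tau_i=(1+\epsilon)^i$ for integers $i\ge -1$,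 $I_0=\{1\}$, and $I_i=(\tau_{i-1},\tau_i]$ for $i\ge1$. For real $t\ge 1$ let $\mathcal{I}(t)=\lceil\log_{1+\epsilon}t\rceil$ (so $t\in I_{\mathcal{I}(t)}$), and $\mathcal{I}(t)=0$ for $t<1$. Let $T_I=\mathcal{I}(T)$ and $\mathcal{T}_I=\{0,1,\dots,T_I\}$. **Aggregated problem (A).** Binary variables $X_{js}$, $j\in\mathcal{J}$, $s\in\mathcal{T}_I$. Maximize $$\widehat{\mathrm{NPV}}(X)=\sum_{j:\,f_j>0}\ \sum_{s\in\mathcal{T}_I}\frac{f_j}{(1+r)^{\tau_{s-1}}}X_{js}+\sum_{j:\,f_j<0}\ \sum_{s\in\mathcal{T}_I}\frac{f_j}{(1+r)^{\tau_s}}X_{js}$$ subject to - $X_{jt}=0$ for $t<\mathcal{I}(p_j)$, $j\in\mathcal{J}$; - $\sum_{t\in\mathcal{T}_I}X_{jt}\le1$ for $j\in\mathcal{J}$; - $\sum_{u=0}^tX_{ju}\le\sum_{u=0}^{\mathcal{I}(\tau_t-\Delta_{jk})}X_{ku}$ for $j\in\mathcal{J}$, $k\in\hat{\mathcal{P}}_j$, $t\in\mathcal{T}_I$, where the right-hand side is read as $0$ if $\tau_t-\Delta_{jk}<1$; - $\sum_{j=1}^N\sum_{u=0}^{\mathcal{I}(\tau_t+p_j)-1}q_{jk}\,(p_j-(\tau_u-\tau_t)^+)\,X_{ju}\le\sum_{s=1}^{\lceil\tau_t\rceil}R_{ks}$ for $t\in\mathcal{T}_I$, $k\in\mathcal{K}$;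 - $X_{jt}\in\{0,1\}$ for $j\in\mathcal{J}$, $t\in\mathcal{T}_I$. *)

theory Defs
  imports Complex_Main
begin

record rcpsp =
  num_jobs :: nat
  horizon :: nat
  num_resources :: nat
  revenue :: "nat \<Rightarrow> real"
  proc_time :: "nat \<Rightarrow> nat"
  requirement :: "nat \<Rightarrow> nat \<Rightarrow> real"  (* job, resource *)
  preds :: "nat \<Rightarrow> nat set"
  arrival :: "nat \<Rightarrow> nat \<Rightarrow> real"  (* resource, period *)
  disc_rate :: real

definition jobs :: "rcpsp \<Rightarrow> nat set" where
  "jobs P = {1..num_jobs P}"

definition periods :: "rcpsp \<Rightarrow> nat set" where
  "periods P = {1..horizon P}"

definition resources :: "rcpsp \<Rightarrow> nat set" where
  "resources P = {1..num_resources P}"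

(* Arcs point from a job to its predecessors. *)
definition prec_arcs :: "rcpsp \<Rightarrow> (nat \<times> nat) set" where
  "prec_arcs P = {(j, k). j \<in> jobs P \<and> k \<in> preds P j}"

(* Fewest arcs among all graphs on the finite vertex set V with the same reachability. *)
definition is_transitive_reduction ::
    "'a set \<Rightarrow> ('a \<times> 'a) set \<Rightarrow> ('a \<times> 'a) set \<Rightarrow> bool" where
  "is_transitive_reduction V A B \<longleftrightarrow>
     B \<subseteq> V \<times> V \<and> B\<^sup>+ = A\<^sup>+ \<and>
     (\<forall>C. C \<subseteq> V \<times> V \<and> C\<^sup>+ = A\<^sup>+ \<longrightarrow> card B \<le> card C)"

definition valid_instance :: "rcpsp \<Rightarrow> bool" where
  "valid_instance P \<longleftrightarrow>
     (\<forall>j\<in>jobs P. proc_time P j \<ge> 1) \<and>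
     (\<forall>j\<in>jobs P. \<forall>k\<in>resources P. requirement P j k \<ge> 0) \<and>
     (\<forall>j\<in>jobs P. preds P j \<subseteq> jobs P) \<and>
     (\<forall>k\<in>resources P. \<forall>t\<in>periods P. arrival P k t \<ge> 0) \<and>
     disc_rate P > 0 \<and>
     acyclic (prec_arcs P) \<and>
     is_transitive_reduction (jobs P) (prec_arcs P) (prec_arcs P)"

definition all_preds :: "rcpsp \<Rightarrow> nat \<Rightarrow> nat set" where
  "all_preds P j = {k. k \<noteq> j \<and> (j, k) \<in> (prec_arcs P)\<^sup>*}"

definition is_path :: "('a \<times> 'a) set \<Rightarrow> 'a \<Rightarrow> 'a list \<Rightarrow> 'a \<Rightarrow> bool" where
  "is_path A u vs v \<longleftrightarrow>
     vs \<noteq> [] \<and> hd vs = u \<and> last vs = v \<and> distinct vs \<and>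
     successively (\<lambda>a b. (a, b) \<in> A) vs"

(* An arc (a, b) has length proc_time P a, so every vertex of the path but the last one counts. *)
definition path_length :: "rcpsp \<Rightarrow> nat list \<Rightarrow> nat" where
  "path_length P vs = sum_list (map (proc_time P) (butlast vs))"

(* Meaningful for k in all_preds P j only: otherwise there may be no path from j to k. *)
definition longest_path :: "rcpsp \<Rightarrow> nat \<Rightarrow> nat \<Rightarrow> nat" where
  "longest_path P j k = Max {path_length P vs |vs. is_path (prec_arcs P) j vs k}"

(* Arrays are extended by 0 outside their index range. *)
definition zero_ext :: "'i set \<Rightarrow> ('i \<Rightarrow> real) \<Rightarrow> 'i \<Rightarrow> real" where
  "zero_ext S a i = (if i \<in> S then a i else 0)"

definition pos_part :: "real \<Rightarrow> real" where
  "pos_part y = max y 0"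

definition npv :: "rcpsp \<Rightarrow> (nat \<Rightarrow> nat \<Rightarrow> real) \<Rightarrow> real" where
  "npv P x = (\<Sum>j\<in>jobs P. \<Sum>t\<in>periods P. revenue P j / (1 + disc_rate P) ^ t * x j t)"

(* If t < p_j then the truncated difference t - p_j is 0, which leaves the sum over
   {1..t - p_j} empty, as it should be. *)
definition feasible :: "rcpsp \<Rightarrow> (nat \<Rightarrow> nat \<Rightarrow> real) \<Rightarrow> bool" where
  "feasible P x \<longleftrightarrow>
     (let x' = (\<lambda>j. zero_ext (periods P) (x j));
          R' = (\<lambda>k. zero_ext (periods P) (arrival P k));
          p = proc_time P
      in
       (\<forall>j\<in>jobs P. \<forall>t\<in>periods P. t < p j \<longrightarrow> x j t = 0) \<and>
       (\<forall>j\<in>jobs P. (\<Sum>t\<in>periods P. x j t) \<le> 1) \<and>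
       (\<forall>j\<in>jobs P. \<forall>k\<in>preds P j. \<forall>t\<in>periods P.
          (\<Sum>u=1..t. x' j u) \<le> (\<Sum>u=1..t - p j. x' k u)) \<and>
       (\<forall>t\<in>periods P. \<forall>k\<in>resources P.
          (\<Sum>j\<in>jobs P. \<Sum>u=1..t + p j - 1.
             requirement P j k * (real (p j) - pos_part (real u - real t)) * x' j u)
          \<le> (\<Sum>u=1..t. R' k u)) \<and>
       (\<forall>j\<in>jobs P. \<forall>t\<in>periods P. x j t \<in> {0, 1}))"

definition tau :: "real \<Rightarrow> int \<Rightarrow> real" where
  "tau \<epsilon> i = (1 + \<epsilon>) powi i"

definition interval_index :: "real \<Rightarrow> real \<Rightarrow> int" where
  "interval_index \<epsilon> t = (if t \<ge> 1 then \<lceil>log (1 + \<epsilon>) t\<rceil> else 0)"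

definition agg_periods :: "rcpsp \<Rightarrow> real \<Rightarrow> int set" where
  "agg_periods P \<epsilon> = {0..interval_index \<epsilon> (real (horizon P))}"

definition agg_npv :: "rcpsp \<Rightarrow> real \<Rightarrow> (nat \<Rightarrow> int \<Rightarrow> real) \<Rightarrow> real" where
  "agg_npv P \<epsilon> X =
     (\<Sum>j\<in>{j\<in>jobs P. revenue P j > 0}. \<Sum>s\<in>agg_periods P \<epsilon>.
        revenue P j / (1 + disc_rate P) powr tau \<epsilon> (s - 1) * X j s) +
     (\<Sum>j\<in>{j\<in>jobs P. revenue P j < 0}. \<Sum>s\<in>agg_periods P \<epsilon>.
        revenue P j / (1 + disc_rate P) powr tau \<epsilon> s * X j s)"

definition agg_feasible :: "rcpsp \<Rightarrow> real \<Rightarrow> (nat \<Rightarrow> int \<Rightarrow> real) \<Rightarrow> bool" where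
  "agg_feasible P \<epsilon> X \<longleftrightarrow>
     (let X' = (\<lambda>j. zero_ext (agg_periods P \<epsilon>) (X j));
          R' = (\<lambda>k. zero_ext (periods P) (arrival P k));
          p = proc_time P
      in
       (\<forall>j\<in>jobs P. \<forall>t\<in>agg_periods P \<epsilon>. t < interval_index \<epsilon> (real (p j)) \<longrightarrow> X j t = 0) \<and>
       (\<forall>j\<in>jobs P. (\<Sum>t\<in>agg_periods P \<epsilon>. X j t) \<le> 1) \<and>
       (\<forall>j\<in>jobs P. \<forall>k\<in>all_preds P j. \<forall>t\<in>agg_periods P \<epsilon>.
          (\<Sum>u=0..t. X' j u)
          \<le> (let y = tau \<epsilon> t - real (longest_path P j k)
             in if y < 1 then 0 else (\<Sum>u=0..interval_index \<epsilon> y. X' k u))) \<and>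
       (\<forall>t\<in>agg_periods P \<epsilon>. \<forall>k\<in>resources P.
          (\<Sum>j\<in>jobs P. \<Sum>u=0..interval_index \<epsilon> (tau \<epsilon> t + real (p j)) - 1.
             requirement P j k * (real (p j) - pos_part (tau \<epsilon> u - tau \<epsilon> t)) * X' j u)
          \<le> (\<Sum>s=1..nat \<lceil>tau \<epsilon> t\<rceil>. R' k s)) \<and>
       (\<forall>j\<in>jobs P. \<forall>t\<in>agg_periods P \<epsilon>. X j t \<in> {0, 1}))"

(* If x is feasible, the finishing period selected by THE is unique whenever one exists. *)
definition aggregate :: "rcpsp \<Rightarrow> real \<Rightarrow> (nat \<Rightarrow> nat \<Rightarrow> real) \<Rightarrow> nat \<Rightarrow> int \<Rightarrow> real" where
  "aggregate P \<epsilon> x j s =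
     (if \<exists>t\<in>periods P. x j t = 1
      then (if s = interval_index \<epsilon> (real (THE t. t \<in> periods P \<and> x j t = 1)) then 1 else 0)
      else 0)"

end

(* Aggregation replaces a finishing period c by the index s with tau (s - 1) < c <= tau s. Finishing
   times are thus only rounded up, by less than one geometric interval: the discount factors in (A)
   are at least as favourable as in (O), jobs are charged at most what they consume in (O), and
   c_k + Delta_jk <= c_j (by adding up the constraints along a longest path) survives since
   c_j <= tau t. The resource constraint of (A) at t follows from that of (O) at the period
   min (ceiling (tau t)) T. *)
theory Submission
  imports Defs
begin

section \<open>Geometric intervals and their indices\<close>

lemma tau_eq_powr:
  assumes "\<epsilon> > 0"
  shows "tau \<epsilon> i = (1 + \<epsilon>) powr real_of_int i"
  using assms by (simp add: tau_def powr_real_of_int')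

text \<open>Galois connection between the rounded logarithm and the powers of 1 + \<epsilon>. Apart
  from nonnegativity, every later fact about \<open>interval_index\<close> comes from it.\<close>

lemma interval_index_le_iff:
  assumes "\<epsilon> > 0" "t \<ge> 1"
  shows "interval_index \<epsilon> t \<le> i \<longleftrightarrow> t \<le> tau \<epsilon> i"
  using assms by (simp add: tau_eq_powr interval_index_def ceiling_le_iff log_le_iff)

lemma less_interval_index_iff:
  assumes "\<epsilon> > 0" "t \<ge> 1"
  shows "i < interval_index \<epsilon> t \<longleftrightarrow> tau \<epsilon> i < t"
  using interval_index_le_iff[OF assms, of i] by linarith

lemma le_tau_interval_index:
  assumes "\<epsilon> > 0" "t \<ge> 1"
  shows "t \<le> tau \<epsilon> (interval_index \<epsilon> t)"
  using interval_index_le_iff[OF assms] by blast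

lemma tau_interval_index_less:
  assumes "\<epsilon> > 0" "t \<ge> 1"
  shows "tau \<epsilon> (interval_index \<epsilon> t - 1) < t"
  using less_interval_index_iff[OF assms, of "interval_index \<epsilon> t - 1"] by simp

lemma tau_mono:
  assumes "\<epsilon> > 0" "i \<le> j"
  shows "tau \<epsilon> i \<le> tau \<epsilon> j"
  using assms by (simp add: tau_eq_powr powr_mono)

lemma one_le_tau:
  assumes "\<epsilon> > 0" "0 \<le> i"
  shows "1 \<le> tau \<epsilon> i"
  using tau_mono[OF assms] by (simp add: tau_def)

lemma interval_index_nonneg:
  assumes "\<epsilon> > 0"
  shows "0 \<le> interval_index \<epsilon> t"
proof (cases "t \<ge> 1")
  case True
  then have "0 \<le> log (1 + \<epsilon>) t"
    using assms by simp
  then show ?thesis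
    using True by (simp add: interval_index_def)
qed (simp add: interval_index_def)

lemma interval_index_mono:
  assumes "\<epsilon> > 0" "1 \<le> s" "s \<le> t"
  shows "interval_index \<epsilon> s \<le> interval_index \<epsilon> t"
  using assms le_tau_interval_index[of \<epsilon> t] by (simp add: interval_index_le_iff)

lemma interval_index_in_agg_periods:
  assumes "\<epsilon> > 0" "c \<in> periods P"
  shows "interval_index \<epsilon> (real c) \<in> agg_periods P \<epsilon>"
  using assms by (auto simp: agg_periods_def periods_def interval_index_nonneg interval_index_mono)

section \<open>Simple paths in an acyclic graph\<close>

lemma is_path_ConsI:
  assumes "(u, v) \<in> A" "is_path A v vs w" "u \<notin> set vs"
  shows "is_path A u (u # vs) w"
  using assms by (auto simp: is_path_def successively_Cons)

text \<open>Since \<open>is_path\<close> demands distinct vertices, prepending u needs u to be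
  absent from the old path. The second conjunct strengthens the induction for this: every old vertex
  is reachable from v, so an occurrence of u would close a cycle through the arc (u, v).\<close>

lemma acyclic_rtrancl_imp_path:
  assumes "acyclic A" "(u, w) \<in> A\<^sup>*"
  shows "\<exists>vs. is_path A u vs w \<and> (\<forall>v\<in>set vs. (u, v) \<in> A\<^sup>*)"
  using assms(2)
proof (induction rule: converse_rtrancl_induct)
  case base
  have "is_path A w [w] w"
    by (simp add: is_path_def)
  then show ?case
    by force
next
  case (step u v)
  then obtain vs where vs: "is_path A v vs w" "\<forall>v'\<in>set vs. (v, v') \<in> A\<^sup>*"
    by blast
  have "u \<notin> set vs"
    using vs(2) step.hyps(1) assms(1) by (meson acyclic_def rtrancl_into_trancl2)
  then have "is_path A u (u # vs) w"
    using step.hyps(1) vs(1) by (rule is_path_ConsI[rotated 2])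
  moreover have "\<forall>v'\<in>set (u # vs). (u, v') \<in> A\<^sup>*"
    using vs(2) step.hyps(1) by (auto intro: converse_rtrancl_into_rtrancl)
  ultimately show ?case
    by blast
qed

section \<open>Feasible schedules as finishing times\<close>

definition finishes_at :: "rcpsp \<Rightarrow> (nat \<Rightarrow> nat \<Rightarrow> real) \<Rightarrow> nat \<Rightarrow> nat \<Rightarrow> bool" where
  "finishes_at P x j c \<longleftrightarrow> c \<in> periods P \<and> (\<forall>t\<in>periods P. x j t = (if t = c then 1 else 0))"

definition unscheduled :: "rcpsp \<Rightarrow> (nat \<Rightarrow> nat \<Rightarrow> real) \<Rightarrow> nat \<Rightarrow> bool" where
  "unscheduled P x j \<longleftrightarrow> (\<forall>t\<in>periods P. x j t = 0)"

text \<open>\<open>finishes_at\<close> fixes the whole row of job j, not just its entry at c; as a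
  rewrite rule this collapses the sums in the constraints of (O) to the single term at c.\<close>

lemma zero_ext_finishes_at:
  assumes "finishes_at P x j c"
  shows "zero_ext (periods P) (x j) t = (if t = c then 1 else 0)"
  using assms by (auto simp: finishes_at_def zero_ext_def)

lemma zero_ext_unscheduled:
  assumes "unscheduled P x j"
  shows "zero_ext (periods P) (x j) t = 0"
  using assms by (auto simp: unscheduled_def zero_ext_def)

lemma finishes_at_bounds:
  assumes "finishes_at P x j c"
  shows "1 \<le> c" "c \<le> horizon P"
  using assms by (auto simp: finishes_at_def periods_def)

lemma schedule_cases:
  assumes "feasible P x" "j \<in> jobs P"
  obtains (finished) c where "finishes_at P x j c" | (unscheduled) "unscheduled P x j"
proof (cases "\<exists>c\<in>periods P. x j c = 1")
  case True
  then obtain c where c: "c \<in> periods P" "x j c = 1"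
    by blast
  have bin: "\<forall>t\<in>periods P. x j t \<in> {0, 1}" and le: "(\<Sum>t\<in>periods P. x j t) \<le> 1"
    using assms by (auto simp: feasible_def Let_def)
  have fin: "finite (periods P)"
    by (simp add: periods_def)
  have "x j t = 0" if "t \<in> periods P" "t \<noteq> c" for t
  proof -
    \<comment> \<open>A second entry equal to 1 would push the row sum to 2.\<close>
    have "x j c + x j t = (\<Sum>u\<in>{c, t}. x j u)"
      using that by simp
    also have "\<dots> \<le> (\<Sum>u\<in>periods P. x j u)"
      using c that fin bin by (intro sum_mono2) force+
    also have "\<dots> \<le> 1"
      by (fact le)
    finally show ?thesis
      using c that bin by force
  qed
  then show ?thesis
    using c by (intro finished[of c]) (auto simp: finishes_at_def)
next
  case False
  moreover have "\<forall>t\<in>periods P. x j t \<in> {0, 1}"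
    using assms by (auto simp: feasible_def Let_def)
  ultimately show ?thesis
    by (intro unscheduled) (auto simp: unscheduled_def)
qed

lemma aggregate_finishes_at:
  assumes "finishes_at P x j c"
  shows "aggregate P \<epsilon> x j s = (if s = interval_index \<epsilon> (real c) then 1 else 0)"
proof -
  have c: "c \<in> periods P" "\<And>t. t \<in> periods P \<Longrightarrow> x j t = (if t = c then 1 else 0)"
    using assms by (simp_all add: finishes_at_def)
  have "(THE t. t \<in> periods P \<and> x j t = 1) = c"
    using c by (intro the_equality) (auto split: if_splits)
  then show ?thesis
    using c by (auto simp: aggregate_def)
qed

lemma aggregate_unscheduled:
  assumes "unscheduled P x j"
  shows "aggregate P \<epsilon> x j s = 0"
  using assms by (auto simp: aggregate_def unscheduled_def)

text \<open>The extension by 0 cuts nothing off: c lies between 1 and the horizon, so its index is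
  in \<open>agg_periods\<close>.\<close>

lemma zero_ext_aggregate_finishes_at:
  assumes "\<epsilon> > 0" "finishes_at P x j c"
  shows "zero_ext (agg_periods P \<epsilon>) (aggregate P \<epsilon> x j) s
    = (if s = interval_index \<epsilon> (real c) then 1 else 0)"
  using interval_index_in_agg_periods[of \<epsilon> c P] assms(1,2)
  by (auto simp: zero_ext_def aggregate_finishes_at[OF assms(2)] finishes_at_def)

lemma zero_ext_aggregate_unscheduled:
  assumes "unscheduled P x j"
  shows "zero_ext (agg_periods P \<epsilon>) (aggregate P \<epsilon> x j) s = 0"
  by (simp add: zero_ext_def aggregate_unscheduled[OF assms])

lemma zero_ext_aggregate_nonneg: "zero_ext S (aggregate P \<epsilon> x j) s \<ge> 0"
  by (simp add: zero_ext_def aggregate_def)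

section \<open>Precedence along arcs and longest paths\<close>

lemma pred_finishes_before:
  assumes "valid_instance P" "feasible P x" "(j, k) \<in> prec_arcs P" "finishes_at P x j c"
  shows "\<exists>d. finishes_at P x k d \<and> d + proc_time P j \<le> c"
proof -
  have jk: "j \<in> jobs P" "k \<in> preds P j"
    using assms(3) by (auto simp: prec_arcs_def)
  then have kj: "k \<in> jobs P"
    using assms(1) by (auto simp: valid_instance_def)
  have c: "c \<in> periods P"
    using assms(4) by (simp add: finishes_at_def)
  \<comment> \<open>The precedence constraint is taken at t = c, the finishing period of j, where
    its left side is 1.\<close>
  have "(\<Sum>u=1..c. zero_ext (periods P) (x j) u)
      \<le> (\<Sum>u=1..c - proc_time P j. zero_ext (periods P) (x k) u)"
    using assms(2) jk c by (auto simp: feasible_def Let_def)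
  then have le: "1 \<le> (\<Sum>u=1..c - proc_time P j. zero_ext (periods P) (x k) u)"
    using finishes_at_bounds[OF assms(4)] by (simp add: zero_ext_finishes_at[OF assms(4)])
  from assms(2) kj show ?thesis
  proof (cases rule: schedule_cases)
    case (finished d)
    then show ?thesis
      \<comment> \<open>The right sum contains d, so 1 \<le> d \<le> c - p_j. Hence the natural
        subtraction did not truncate, and p_j can be moved to the other side.\<close>
      using le by (auto simp: zero_ext_finishes_at split: if_splits)
  next
    case unscheduled
    then show ?thesis
      using le by (simp add: zero_ext_unscheduled)
  qed
qed

text \<open>Each arc (a, b) forces b to finish at least p_a periods before a, and these gaps
  telescope along the path. The last vertex adds no gap, in accordance with \<open>butlast\<close>
  in \<open>path_length\<close>.\<close>

lemma path_finishes_before: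
  assumes "valid_instance P" "feasible P x"
    and "is_path (prec_arcs P) j vs k" "finishes_at P x j c"
  shows "\<exists>d. finishes_at P x k d \<and> d + path_length P vs \<le> c"
  using assms(3,4)
proof (induction vs arbitrary: j c)
  case Nil
  then show ?case
    by (simp add: is_path_def)
next
  case (Cons v vs)
  show ?case
  proof (cases "vs = []")
    case True
    then show ?thesis
      using Cons.prems by (auto simp: is_path_def path_length_def)
  next
    case False
    then have arc: "(j, hd vs) \<in> prec_arcs P" and path: "is_path (prec_arcs P) (hd vs) vs k"
      and v: "v = j"
      using Cons.prems(1) by (auto simp: is_path_def successively_Cons)
    obtain d where d: "finishes_at P x (hd vs) d" "d + proc_time P j \<le> c"
      using pred_finishes_before[OF assms(1,2) arc Cons.prems(2)] by blast
    obtain e where "finishes_at P x k e" "e + path_length P vs \<le> d"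
      using Cons.IH[OF path d(1)] by blast
    then show ?thesis
      using d(2) False v by (intro exI[of _ e]) (simp add: path_length_def)
  qed
qed

lemma all_preds_finish_before:
  assumes "valid_instance P" "feasible P x" "k \<in> all_preds P j" "finishes_at P x j c"
  shows "\<exists>d. finishes_at P x k d \<and> d + longest_path P j k \<le> c"
proof -
  define L where "L = {path_length P vs |vs. is_path (prec_arcs P) j vs k}"
  \<comment> \<open>Finiteness of the set of path lengths comes from the schedule itself: no path
    from j to k can be longer than c. Together with nonemptiness it makes \<open>Max\<close> an
    attained length.\<close>
  have "L \<subseteq> {..c}"
    using path_finishes_before[OF assms(1,2) _ assms(4)] by (fastforce simp: L_def)
  then have "finite L"
    by (rule finite_subset) simp
  moreover have "L \<noteq> {}"
    using acyclic_rtrancl_imp_path[of "prec_arcs P" j k] assms(1,3)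
    by (auto simp: L_def valid_instance_def all_preds_def)
  ultimately have "longest_path P j k \<in> L"
    unfolding longest_path_def L_def by (rule Max_in)
  then show ?thesis
    using path_finishes_before[OF assms(1,2) _ assms(4)] by (auto simp: L_def)
qed

section \<open>Feasibility of the aggregated schedule\<close>

lemma sum_aggregate_le_1:
  assumes "feasible P x" "j \<in> jobs P"
  shows "(\<Sum>t\<in>agg_periods P \<epsilon>. aggregate P \<epsilon> x j t) \<le> 1"
  using assms
  by (cases rule: schedule_cases)
    (simp_all add: agg_periods_def aggregate_finishes_at aggregate_unscheduled)

lemma aggregate_release:
  assumes "valid_instance P" "\<epsilon> > 0" "feasible P x" "j \<in> jobs P"
    and "t < interval_index \<epsilon> (real (proc_time P j))"
  shows "aggregate P \<epsilon> x j t = 0"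
  using assms(3,4)
proof (cases rule: schedule_cases)
  case (finished c)
  have "\<forall>u\<in>periods P. u < proc_time P j \<longrightarrow> x j u = 0"
    using assms(3,4) by (simp add: feasible_def Let_def)
  then have "proc_time P j \<le> c"
    using finished by (force simp: finishes_at_def)
  moreover have "proc_time P j \<ge> 1"
    using assms(1,4) by (simp add: valid_instance_def)
  ultimately have "interval_index \<epsilon> (real (proc_time P j)) \<le> interval_index \<epsilon> (real c)"
    using assms(2) by (intro interval_index_mono) auto
  then show ?thesis
    using assms(5) by (simp add: aggregate_finishes_at[OF finished])
qed (rule aggregate_unscheduled)

text \<open>The left side is 1 only if c \<le> \<open>tau \<epsilon> t\<close>; then k finishes at
  some d \<le> c - \<open>longest_path P j k\<close> \<le> y. As d \<ge> 1, the default branch y < 1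
  is excluded, and the index of d is at most that of y.\<close>

lemma aggregate_precedence:
  fixes t :: int
  assumes "valid_instance P" "\<epsilon> > 0" "feasible P x" "j \<in> jobs P" "k \<in> all_preds P j"
  defines "X \<equiv> \<lambda>j. zero_ext (agg_periods P \<epsilon>) (aggregate P \<epsilon> x j)"
    and "y \<equiv> tau \<epsilon> t - real (longest_path P j k)"
  shows "(\<Sum>u=0..t. X j u) \<le> (if y < 1 then 0 else (\<Sum>u=0..interval_index \<epsilon> y. X k u))"
    (is "?L \<le> ?R")
  using assms(3,4)
proof (cases rule: schedule_cases)
  case (finished c)
  have R: "?R \<ge> 0"
    by (simp add: X_def zero_ext_aggregate_nonneg sum_nonneg)
  have L: "?L = (if 0 \<le> interval_index \<epsilon> (real c) \<and> interval_index \<epsilon> (real c) \<le> t then 1 else 0)"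
    by (simp add: X_def zero_ext_aggregate_finishes_at[OF assms(2) finished])
  show ?thesis
  proof (cases "interval_index \<epsilon> (real c) \<le> t")
    case True
    then have ct: "real c \<le> tau \<epsilon> t"
      using finishes_at_bounds[OF finished] assms(2) by (simp add: interval_index_le_iff)
    obtain d where d: "finishes_at P x k d" "d + longest_path P j k \<le> c"
      using all_preds_finish_before[OF assms(1,3,5) finished] by blast
    have d1: "real d \<ge> 1"
      using finishes_at_bounds[OF d(1)] by simp
    have dy: "real d \<le> y"
      using ct d(2) by (simp add: y_def)
    then have "?R = 1"
      using d1 assms(2) interval_index_mono[of \<epsilon> "real d" y]
      by (simp add: X_def zero_ext_aggregate_finishes_at[OF assms(2) d(1)] interval_index_nonneg)
    then show ?thesis
      using L by simp
  next
    case False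
    then show ?thesis
      using L R by simp
  qed
next
  case unscheduled
  then show ?thesis
    by (simp add: X_def zero_ext_aggregate_unscheduled zero_ext_aggregate_nonneg sum_nonneg)
qed

text \<open>m is the period of (O) against which t is compared. Under either alternative for m, the
  positive part of c - m is at most that of \<open>tau \<epsilon> i - tau \<epsilon> t\<close>: if
  \<open>tau \<epsilon> t\<close> \<le> m because c \<le> \<open>tau \<epsilon> i\<close>, and if m
  is the horizon because c - m \<le> 0. Both upper summation limits keep exactly the terms in which
  the factor of q is positive.\<close>

lemma job_consumption_aggregate_le:
  fixes q :: real and p m :: nat
  assumes "\<epsilon> > 0" "feasible P x" "j \<in> jobs P" "q \<ge> 0" "p \<ge> 1" "t \<ge> 0"
    and m: "tau \<epsilon> t \<le> real m \<or> m = horizon P"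
  shows "(\<Sum>u=0..interval_index \<epsilon> (tau \<epsilon> t + real p) - 1.
            q * (real p - pos_part (tau \<epsilon> u - tau \<epsilon> t))
              * zero_ext (agg_periods P \<epsilon>) (aggregate P \<epsilon> x j) u)
    \<le> (\<Sum>u=1..m + p - 1. q * (real p - pos_part (real u - real m)) * zero_ext (periods P) (x j) u)"
    (is "?L \<le> ?R")
  using assms(2,3)
proof (cases rule: schedule_cases)
  case (finished c)
  define i where "i = interval_index \<epsilon> (real c)"
  define b where "b = interval_index \<epsilon> (tau \<epsilon> t + real p) - 1"
  have c: "1 \<le> c" "c \<le> horizon P"
    using finishes_at_bounds[OF finished] by auto
  have L: "?L = (if i \<le> b then q * (real p - pos_part (tau \<epsilon> i - tau \<epsilon> t)) else 0)"
    using assms(1)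
    by (simp add: zero_ext_aggregate_finishes_at[OF assms(1) finished] i_def b_def
        interval_index_nonneg if_distrib[of "(*) _"] cong: if_cong)
  have R: "?R = (if c \<le> m + p - 1 then q * (real p - pos_part (real c - real m)) else 0)"
    using c
    by (simp add: zero_ext_finishes_at[OF finished] if_distrib[of "(*) _"] cong: if_cong)
  show ?thesis
  proof (cases "i \<le> b")
    case True
    have ci: "real c \<le> tau \<epsilon> i"
      unfolding i_def using assms(1) c by (intro le_tau_interval_index) auto
    have "1 \<le> tau \<epsilon> t"
      using assms(1) \<open>t \<ge> 0\<close> by (rule one_le_tau)
    then have less: "tau \<epsilon> i < tau \<epsilon> t + real p"
      using True assms(1) less_interval_index_iff[of \<epsilon> "tau \<epsilon> t + real p" i] by (simp add: b_def)
    have pos: "pos_part (real c - real m) \<le> pos_part (tau \<epsilon> i - tau \<epsilon> t)"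
      using m ci c by (auto simp: pos_part_def)
    have "real c - real m < real p"
      \<comment> \<open>The positive part of c - m is bounded by that of
        \<open>tau \<epsilon> i - tau \<epsilon> t\<close>, which is below p. So a job counted in
        (A) at t is also counted in (O) at m.\<close>
      using pos less ci m c \<open>p \<ge> 1\<close> by (auto simp: pos_part_def max_def split: if_splits)
    moreover have "c \<le> m + p - 1 \<longleftrightarrow> c < m + p"
      using c by auto
    ultimately have "c \<le> m + p - 1"
      by linarith
    then show ?thesis
      using L R True pos \<open>q \<ge> 0\<close> by (simp add: mult_left_mono)
  next
    case False
    \<comment> \<open>The job is not counted in (A), so it suffices that its consumption in (O) is
      nonnegative.\<close>
    have "c \<le> m + p - 1 \<Longrightarrow> pos_part (real c - real m) \<le> real p"
      using c by (auto simp: pos_part_def)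
    then show ?thesis
      using L R False \<open>q \<ge> 0\<close> by simp
  qed
next
  case unscheduled
  then show ?thesis
    by (simp add: zero_ext_aggregate_unscheduled zero_ext_unscheduled)
qed

lemma aggregate_resource:
  assumes "valid_instance P" "\<epsilon> > 0" "feasible P x" "t \<ge> 0" "k \<in> resources P"
  shows "(\<Sum>j\<in>jobs P. \<Sum>u=0..interval_index \<epsilon> (tau \<epsilon> t + real (proc_time P j)) - 1.
            requirement P j k * (real (proc_time P j) - pos_part (tau \<epsilon> u - tau \<epsilon> t))
              * zero_ext (agg_periods P \<epsilon>) (aggregate P \<epsilon> x j) u)
    \<le> (\<Sum>s=1..nat \<lceil>tau \<epsilon> t\<rceil>. zero_ext (periods P) (arrival P k) s)"
    (is "?L \<le> ?R")
\<comment> \<open>With an empty horizon (O) has no resource constraint to appeal to, while (A) still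
  has the index 0; both sides are then 0.\<close>
proof (cases "horizon P = 0")
  case True
  then have "unscheduled P x j" for j
    by (simp add: unscheduled_def periods_def)
  then have "?L = 0"
    by (simp add: zero_ext_aggregate_unscheduled)
  moreover have "?R = 0"
    using True by (simp add: zero_ext_def periods_def)
  ultimately show ?thesis
    by simp
next
  case False
  \<comment> \<open>(O) has constraints only up to the horizon, whereas the last geometric interval
    may reach beyond it; hence the minimum.\<close>
  define m where "m = min (nat \<lceil>tau \<epsilon> t\<rceil>) (horizon P)"
  have "1 \<le> tau \<epsilon> t"
    using assms(2,4) by (rule one_le_tau)
  then have m: "m \<in> periods P"
    using False by (auto simp: m_def periods_def Suc_le_eq)
  have m': "tau \<epsilon> t \<le> real m \<or> m = horizon P"
    by (simp add: m_def min_def real_nat_ceiling_ge)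
  have "?L \<le> (\<Sum>j\<in>jobs P. \<Sum>u=1..m + proc_time P j - 1.
      requirement P j k * (real (proc_time P j) - pos_part (real u - real m))
        * zero_ext (periods P) (x j) u)"
    using assms m' by (intro sum_mono job_consumption_aggregate_le) (auto simp: valid_instance_def)
  also have "\<dots> \<le> (\<Sum>s=1..m. zero_ext (periods P) (arrival P k) s)"
    using assms(3,5) m by (simp add: feasible_def Let_def)
  also have "\<dots> = ?R"
    \<comment> \<open>Periods between m and the rounded \<open>tau \<epsilon> t\<close> exist only
      beyond the horizon, where the extended arrivals vanish.\<close>
    by (rule sum.mono_neutral_left) (auto simp: m_def zero_ext_def periods_def)
  finally show ?thesis .
qed

lemma agg_feasible_aggregate:
  assumes "valid_instance P" "\<epsilon> > 0" "feasible P x"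
  shows "agg_feasible P \<epsilon> (aggregate P \<epsilon> x)"
  unfolding agg_feasible_def Let_def
proof (intro conjI ballI impI)
  fix t k
  assume "t \<in> agg_periods P \<epsilon>" "k \<in> resources P"
  then show "(\<Sum>j\<in>jobs P. \<Sum>u=0..interval_index \<epsilon> (tau \<epsilon> t + real (proc_time P j)) - 1.
            requirement P j k * (real (proc_time P j) - pos_part (tau \<epsilon> u - tau \<epsilon> t))
              * zero_ext (agg_periods P \<epsilon>) (aggregate P \<epsilon> x j) u)
    \<le> (\<Sum>s=1..nat \<lceil>tau \<epsilon> t\<rceil>. zero_ext (periods P) (arrival P k) s)"
    using assms by (intro aggregate_resource) (auto simp: agg_periods_def)
next
  fix j t
  show "aggregate P \<epsilon> x j t \<in> {0, 1}"
    by (simp add: aggregate_def)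
qed (rule sum_aggregate_le_1 aggregate_release aggregate_precedence; (use assms in simp))+

section \<open>Comparison of the objectives, job by job\<close>

lemma job_npv_aggregate_le:
  fixes f :: real
  assumes "\<epsilon> > 0" "disc_rate P > 0" "feasible P x" "j \<in> jobs P"
  shows "(\<Sum>t\<in>periods P. f / (1 + disc_rate P) ^ t * x j t)
    \<le> (if f > 0 then \<Sum>s\<in>agg_periods P \<epsilon>.
          f / (1 + disc_rate P) powr tau \<epsilon> (s - 1) * aggregate P \<epsilon> x j s else 0)
    + (if f < 0 then \<Sum>s\<in>agg_periods P \<epsilon>.
          f / (1 + disc_rate P) powr tau \<epsilon> s * aggregate P \<epsilon> x j s else 0)"
  using assms(3,4)
proof (cases rule: schedule_cases)
  case (finished c)
  define i where "i = interval_index \<epsilon> (real c)"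
  define r where "r = 1 + disc_rate P"
  have r: "r > 1"
    using assms(2) by (simp add: r_def)
  have c: "c \<in> periods P" "1 \<le> real c"
    using finished finishes_at_bounds[OF finished] by (auto simp: finishes_at_def)
  have i: "i \<in> agg_periods P \<epsilon>"
    unfolding i_def using assms(1) c(1) by (rule interval_index_in_agg_periods)
  have "(\<Sum>t\<in>periods P. f / r ^ t * x j t) = (\<Sum>t\<in>periods P. if t = c then f / r ^ t else 0)"
    using finished by (intro sum.cong) (auto simp: finishes_at_def)
  \<comment> \<open>(A) discounts by real exponents, so the natural power of (O) is turned into
    \<open>powr\<close>.\<close>
  also have "\<dots> = f / r powr real c"
    using c(1) r by (simp add: periods_def powr_realpow)
  finally have L: "(\<Sum>t\<in>periods P. f / r ^ t * x j t) = f / r powr real c" .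
  \<comment> \<open>A generic weight g covers both the discounting at
    \<open>tau \<epsilon> (s - 1)\<close> and that at \<open>tau \<epsilon> s\<close>.\<close>
  have R: "(\<Sum>s\<in>agg_periods P \<epsilon>. g s * aggregate P \<epsilon> x j s) = g i" for g
    using i by (simp add: aggregate_finishes_at[OF finished] i_def agg_periods_def
        if_distrib[of "(*) _"] cong: if_cong)
  \<comment> \<open>c lies between the two ends of its interval. Gains are discounted at the left
    end and costs at the right end, so either sign of f favours (A).\<close>
  have "r powr tau \<epsilon> (i - 1) \<le> r powr real c" "r powr real c \<le> r powr tau \<epsilon> i"
    using tau_interval_index_less[OF assms(1) c(2)] le_tau_interval_index[OF assms(1) c(2)] r
    by (simp_all add: i_def powr_mono)
  then have "f > 0 \<Longrightarrow> f / r powr real c \<le> f / r powr tau \<epsilon> (i - 1)"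
    and "f < 0 \<Longrightarrow> f / r powr real c \<le> f / r powr tau \<epsilon> i"
    using r by (simp_all add: divide_left_mono divide_left_mono_neg del: powr_le_cancel_iff)
  then show ?thesis
    using L unfolding r_def[symmetric] R by (cases f "0::real" rule: linorder_cases) auto
next
  case unscheduled
  then show ?thesis
    by (simp add: aggregate_unscheduled unscheduled_def)
qed

lemma npv_le_agg_npv_aggregate:
  assumes "\<epsilon> > 0" "disc_rate P > 0" "feasible P x"
  shows "npv P x \<le> agg_npv P \<epsilon> (aggregate P \<epsilon> x)"
proof -
  have fin: "finite (jobs P)"
    by (simp add: jobs_def)
  show ?thesis
    \<comment> \<open>\<open>sum.inter_filter\<close> turns the sums over jobs of positive and of
      negative revenue into sums over all jobs with a conditional, so that they merge and can be
      compared termwise.\<close>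
    unfolding npv_def agg_npv_def sum.inter_filter[OF fin] sum.distrib[symmetric]
    using assms by (intro sum_mono job_npv_aggregate_le)
qed

theorem proposition1:
  fixes P :: rcpsp and \<epsilon> :: real and x :: "nat \<Rightarrow> nat \<Rightarrow> real"
  assumes "valid_instance P"
    and "\<epsilon> > 0"
    and "feasible P x"
  shows "agg_feasible P \<epsilon> (aggregate P \<epsilon> x)
    \<and> npv P x \<le> agg_npv P \<epsilon> (aggregate P \<epsilon> x)"
  using assms
  by (simp add: agg_feasible_aggregate npv_le_agg_npv_aggregate valid_instance_def)

end
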